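(* Let $T>0$ and assume that $N\leqslant d$. Let $\mathbf{x}^1\in\mathbb{R}^{d_x}$ be given, and assume that the activation function $\sigma\in C^1(\mathbb{R})\cap\mathrm{Lip}(\mathbb{R})$ is such that $$\big\{\sigma(\mathbf{x}_1^1),\dots,\sigma(\mathbf{x}_i^1),\dots,\sigma(\mathbf{x}_N^1)\big\}$$ is a system of linearly independent vectors in $\mathbb{R}^d$. Then there exist universal constants $r>0$ and $\mathfrak{C}>0$ such that for any datum $\mathbf{x}^0\in\mathbb{R}^{d_x}$ satisfying $\|\mathbf{x}^0-\mathbf{x}^1\|\leqslant r$, there exists a weight matrix $w\in L^\infty(0,T;\mathbb{R}^{d\times d})$ such that the unique solution $\mathbf{x}(\cdot)$ to $$\dot{\mathbf{x}}(t)=\mathbf{w}(t)\sigma(\mathbf{x}(t))\ \text{ in }(0,T),\qquad \mathbf{x}(0)=\mathbf{x}^0,$$ satisfies $\mathbf{x}(T)=\mathbf{x}^1$, and the following estimate holds: $$\|w\|_{L^\infty(0,T;\mathbb{R}^{d\times d})}\leqslant\frac{\mathfrak{C}}{T}\|\mathbf{x}^0-\mathbf{x}^1\|.$$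
   Context: $N,d\geqslant1$ are integers and $d_x:=dN$. A vector $\mathbf{x}\in\mathbb{R}^{d_x}$ is viewed as a stack of $N$ sub-vectors $\mathbf{x}_i\in\mathbb{R}^d$, $i=1,\dots,N$. Given $w\in\mathbb{R}^{d\times d}$, $\mathbf{w}\in\mathbb{R}^{d_x\times d_x}$ is the block-diagonal matrix with $N$ diagonal blocks equal to $w$ (so the system reads $\dot{\mathbf{x}}_i=w(t)\sigma(\mathbf{x}_i)$ for each $i$, with the same $w$). $\sigma$ is applied componentwise to vectors, $\mathrm{Lip}(\mathbb{R})$ is the set of globally Lipschitz functions $\mathbb{R}\to\mathbb{R}$, and $\|\cdot\|$ is the Euclidean norm of vectors and the Frobenius norm of matrices. *)

theory Defs
  imports "HOL-Probability.Essential_Supremum"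
begin

text \<open>Stacked vectors, with N = \<open>CARD('n)\<close> and d = \<open>CARD('d)\<close>, have index type \<open>'n \<times> 'd\<close>, of
  cardinality dN: component \<open>(i, k)\<close> is the k-th entry of the i-th sub-vector.\<close>

definition subvec :: "real ^ ('n::finite \<times> 'd::finite) \<Rightarrow> 'n \<Rightarrow> real ^ 'd" where
  "subvec x i = (\<chi> k. x $ (i, k))"

definition block_diag :: "real ^ 'd ^ 'd \<Rightarrow> real ^ ('n::finite \<times> 'd::finite) ^ ('n \<times> 'd)" where
  "block_diag w = (\<chi> p q. if fst p = fst q then w $ snd p $ snd q else 0)"

definition componentwise :: "(real \<Rightarrow> real) \<Rightarrow> real ^ 'm::finite \<Rightarrow> real ^ 'm" where
  "componentwise \<sigma> v = (\<chi> k. \<sigma> (v $ k))"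

text \<open>Linear independence of an indexed family: \<^const>\<open>independent\<close> concerns sets and would not
  notice a repeated vector, hence the injectivity requirement.\<close>

definition independent_family :: "('i \<Rightarrow> 'a::real_vector) \<Rightarrow> bool" where
  "independent_family v \<longleftrightarrow> inj v \<and> independent (range v)"

text \<open>Absolute continuity on \<open>{a..b}\<close>. The finite set \<open>P\<close> collects the endpoint pairs of
  non-overlapping subintervals; degenerate pairs \<open>(s, s)\<close> are harmless.\<close>

definition absolutely_continuous_interval ::
    "real \<Rightarrow> real \<Rightarrow> (real \<Rightarrow> 'a::real_normed_vector) \<Rightarrow> bool" where
  "absolutely_continuous_interval a b f \<longleftrightarrow>
     (\<forall>\<epsilon>>0. \<exists>\<delta>>0. \<forall>P. finite P
         \<and> (\<forall>(s, t)\<in>P. a \<le> s \<and> s \<le> t \<and> t \<le> b)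
         \<and> pairwise (\<lambda>p q. disjnt {fst p<..<snd p} {fst q<..<snd q}) P
         \<and> (\<Sum>(s, t)\<in>P. t - s) < \<delta>
       \<longrightarrow> (\<Sum>(s, t)\<in>P. norm (f t - f s)) < \<epsilon>)"

text \<open>The \<open>L\<^sup>\<infinity>(0,T)\<close> norm and space. The norm of \<^typ>\<open>real ^ 'd ^ 'd\<close> is the Frobenius norm.\<close>

definition Linf_norm :: "real \<Rightarrow> (real \<Rightarrow> 'a::euclidean_space) \<Rightarrow> ereal" where
  "Linf_norm T w = esssup (lebesgue_on {0<..<T}) (\<lambda>t. ereal (norm (w t)))"

definition Linf :: "real \<Rightarrow> (real \<Rightarrow> 'a::euclidean_space) set" where
  "Linf T = {w. w \<in> borel_measurable (lebesgue_on {0<..<T}) \<and> Linf_norm T w < \<infinity>}"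

text \<open>As \<open>w\<close> is merely measurable in time, solutions are understood in the sense of Caratheodory.\<close>

definition is_solution ::
    "(real \<Rightarrow> real) \<Rightarrow> real \<Rightarrow> (real \<Rightarrow> real ^ 'd ^ 'd) \<Rightarrow> real ^ ('n::finite \<times> 'd::finite)
      \<Rightarrow> (real \<Rightarrow> real ^ ('n \<times> 'd)) \<Rightarrow> bool" where
  "is_solution \<sigma> T w x0 x \<longleftrightarrow>
     absolutely_continuous_interval 0 T x
     \<and> (AE t in lebesgue_on {0<..<T}.
          (x has_vector_derivative block_diag (w t) *v componentwise \<sigma> (x t)) (at t))
     \<and> x 0 = x0"

end

(* The straight segment x(t) from x0 to x1 is itself an admissible trajectory. The columns
   sigma(x_i(t)) stay linearly independent near x1, so the matrix S(x) they form has a left inverse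
   G(x) depending continuously on x, and w(t) = V G(x(t)) satisfies w(t) S(x(t)) = V, where V has the
   constant velocities of the sub-vectors as columns. The norm of V is proportional to |x0 - x1| / T
   and G is bounded on a closed ball around x1. Uniqueness is Gronwall's argument for absolutely
   continuous functions. *)

theory Submission
  imports Defs
begin

text \<open>Existence is linear algebra; most of the length is due to uniqueness. The difference z
  of two Caratheodory solutions is differentiable only almost everywhere, so the inequality norm z'
  <= K * norm z may fail on a null set, and the classical mean value theorem does not apply. Its
  replacement is a mean value inequality for absolutely continuous functions, proved with gauges and
  tagged divisions and without integrating z'. Only inequalities between norms are compared, so
  vector values cost nothing.

  The constants are universal because T enters only through the velocity (x1 - x0) / T: the set
  traced by the segment, and hence the ball on which the left inverse must exist and be bounded,
  does not depend on T.\<close>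

section \<open>Absolutely continuous functions on an interval\<close>

definition interval_family :: "real \<Rightarrow> real \<Rightarrow> (real \<times> real) set \<Rightarrow> bool" where
  "interval_family a b P \<longleftrightarrow> finite P
     \<and> (\<forall>(s, t)\<in>P. a \<le> s \<and> s \<le> t \<and> t \<le> b)
     \<and> pairwise (\<lambda>p q. disjnt {fst p<..<snd p} {fst q<..<snd q}) P"

lemma interval_familyD:
  assumes "interval_family a b P" "(s, t) \<in> P"
  shows "a \<le> s" "s \<le> t" "t \<le> b"
  using assms unfolding interval_family_def by auto

lemma interval_family_mono:
  assumes "interval_family c d P" "a \<le> c" "d \<le> b"
  shows "interval_family a b P"
  using assms unfolding interval_family_def by fastforce

lemma absolutely_continuous_interval_iff:
  "absolutely_continuous_interval a b f \<longleftrightarrow>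
    (\<forall>e>0. \<exists>\<delta>>0. \<forall>P. interval_family a b P \<longrightarrow> (\<Sum>(s, t)\<in>P. t - s) < \<delta>
      \<longrightarrow> (\<Sum>(s, t)\<in>P. norm (f t - f s)) < e)"
  unfolding absolutely_continuous_interval_def interval_family_def imp_conjL ..

lemma absolutely_continuous_interval_subset:
  assumes "absolutely_continuous_interval a b f" "a \<le> c" "d \<le> b"
  shows "absolutely_continuous_interval c d f"
  unfolding absolutely_continuous_interval_iff
proof (intro allI impI)
  fix e :: real assume "0 < e"
  with assms(1) obtain \<delta> where "0 < \<delta>" and
    \<delta>: "\<forall>P. interval_family a b P \<longrightarrow> (\<Sum>(s, t)\<in>P. t - s) < \<delta>
      \<longrightarrow> (\<Sum>(s, t)\<in>P. norm (f t - f s)) < e"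
    unfolding absolutely_continuous_interval_iff by meson
  show "\<exists>\<delta>>0. \<forall>P. interval_family c d P \<longrightarrow> (\<Sum>(s, t)\<in>P. t - s) < \<delta>
      \<longrightarrow> (\<Sum>(s, t)\<in>P. norm (f t - f s)) < e"
    using \<open>0 < \<delta>\<close> \<delta> interval_family_mono[OF _ assms(2,3)] by blast
qed

lemma absolutely_continuous_interval_diff:
  assumes "absolutely_continuous_interval a b f" "absolutely_continuous_interval a b g"
  shows "absolutely_continuous_interval a b (\<lambda>t. f t - g t)"
  unfolding absolutely_continuous_interval_iff
proof (intro allI impI)
  fix e :: real assume "0 < e"
  then have e2: "0 < e / 2" by simp
  obtain \<delta> where "0 < \<delta>" and
    \<delta>: "\<forall>P. interval_family a b P \<longrightarrow> (\<Sum>(s, t)\<in>P. t - s) < \<delta>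
      \<longrightarrow> (\<Sum>(s, t)\<in>P. norm (f t - f s)) < e / 2"
    using assms(1) e2 unfolding absolutely_continuous_interval_iff by meson
  obtain \<eta> where "0 < \<eta>" and
    \<eta>: "\<forall>P. interval_family a b P \<longrightarrow> (\<Sum>(s, t)\<in>P. t - s) < \<eta>
      \<longrightarrow> (\<Sum>(s, t)\<in>P. norm (g t - g s)) < e / 2"
    using assms(2) e2 unfolding absolutely_continuous_interval_iff by meson
  show "\<exists>\<delta>>0. \<forall>P. interval_family a b P \<longrightarrow> (\<Sum>(s, t)\<in>P. t - s) < \<delta>
      \<longrightarrow> (\<Sum>(s, t)\<in>P. norm (f t - g t - (f s - g s))) < e"
  proof (intro exI[of _ "min \<delta> \<eta>"] conjI allI impI)
    show "0 < min \<delta> \<eta>" using \<open>0 < \<delta>\<close> \<open>0 < \<eta>\<close> by simp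
    fix P :: "(real \<times> real) set"
    assume P: "interval_family a b P" "(\<Sum>(s, t)\<in>P. t - s) < min \<delta> \<eta>"
    have "(\<Sum>(s, t)\<in>P. norm (f t - g t - (f s - g s)))
        \<le> (\<Sum>(s, t)\<in>P. norm (f t - f s) + norm (g t - g s))"
    proof (rule sum_mono, clarify)
      fix s t
      have "f t - g t - (f s - g s) = (f t - f s) - (g t - g s)" by simp
      then show "norm (f t - g t - (f s - g s)) \<le> norm (f t - f s) + norm (g t - g s)"
        using norm_triangle_ineq4 by metis
    qed
    also have "\<dots> = (\<Sum>(s, t)\<in>P. norm (f t - f s)) + (\<Sum>(s, t)\<in>P. norm (g t - g s))"
      by (simp add: sum.distrib case_prod_unfold)
    also have "\<dots> < e / 2 + e / 2"
      using P \<delta> \<eta> by (intro add_strict_mono) auto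
    finally show "(\<Sum>(s, t)\<in>P. norm (f t - g t - (f s - g s))) < e" by simp
  qed
qed

lemma lipschitz_imp_absolutely_continuous_interval:
  assumes "C-lipschitz_on {a..b} f"
  shows "absolutely_continuous_interval a b f"
  unfolding absolutely_continuous_interval_iff
proof (intro allI impI)
  fix e :: real assume "0 < e"
  have C: "0 \<le> C" using assms lipschitz_on_nonneg by blast
  show "\<exists>\<delta>>0. \<forall>P. interval_family a b P \<longrightarrow> (\<Sum>(s, t)\<in>P. t - s) < \<delta>
      \<longrightarrow> (\<Sum>(s, t)\<in>P. norm (f t - f s)) < e"
  \<comment> \<open>Dividing by \<open>C + 1\<close> instead of \<open>C\<close> covers
    \<open>C = 0\<close> and makes the final inequality strict.\<close>
  proof (intro exI[of _ "e / (C + 1)"] conjI allI impI)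
    show "0 < e / (C + 1)" using \<open>0 < e\<close> C by simp
    fix P :: "(real \<times> real) set"
    assume P: "interval_family a b P" "(\<Sum>(s, t)\<in>P. t - s) < e / (C + 1)"
    have "norm (f t - f s) \<le> C * (t - s)" if "(s, t) \<in> P" for s t
      using lipschitz_onD[OF assms, of t s] interval_familyD[OF P(1) that] by (simp add: dist_norm)
    then have "(\<Sum>(s, t)\<in>P. norm (f t - f s)) \<le> (\<Sum>(s, t)\<in>P. C * (t - s))"
      by (intro sum_mono) auto
    also have "\<dots> = C * (\<Sum>(s, t)\<in>P. t - s)"
      by (simp add: sum_distrib_left case_prod_unfold)
    also have "\<dots> \<le> C * (e / (C + 1))"
      using P C by (intro mult_left_mono) auto
    also have "\<dots> < e" using \<open>0 < e\<close> C by (simp add: field_simps)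
    finally show "(\<Sum>(s, t)\<in>P. norm (f t - f s)) < e" .
  qed
qed

lemma absolutely_continuous_interval_imp_continuous_on:
  assumes "absolutely_continuous_interval a b f"
  shows "continuous_on {a..b} f"
  unfolding continuous_on_iff
proof (intro ballI allI impI)
  fix x e :: real assume x: "x \<in> {a..b}" and "0 < e"
  obtain \<delta> where "0 < \<delta>" and
    \<delta>: "\<forall>P. interval_family a b P \<longrightarrow> (\<Sum>(s, t)\<in>P. t - s) < \<delta>
      \<longrightarrow> (\<Sum>(s, t)\<in>P. norm (f t - f s)) < e"
    using assms \<open>0 < e\<close> unfolding absolutely_continuous_interval_iff by meson
  have "dist (f y) (f x) < e" if "y \<in> {a..b}" "dist y x < \<delta>" for y
  proof -
    \<comment> \<open>A single interval is an admissible family; \<open>min\<close> and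
      \<open>max\<close> order its endpoints, since \<open>y\<close> may lie on either side of
      \<open>x\<close>.\<close>
    have "interval_family a b {(min x y, max x y)}"
      using x that by (auto simp: interval_family_def)
    moreover have "max x y - min x y < \<delta>"
      using that by (auto simp: dist_real_def)
    ultimately have "norm (f (max x y) - f (min x y)) < e"
      using \<delta> by fastforce
    then show ?thesis
      by (cases "x \<le> y") (auto simp: dist_norm norm_minus_commute max_def min_def)
  qed
  then show "\<exists>d>0. \<forall>x'\<in>{a..b}. dist x' x < d \<longrightarrow> dist (f x') (f x) < e"
    using \<open>0 < \<delta>\<close> by blast
qed

section \<open>A mean value inequality with an exceptional null set\<close>

text \<open>Because \<open>t\<close> lies between \<open>u\<close> and \<open>v\<close>, the errors
  of the two one-sided increments, \<open>e * (v - t)\<close> and \<open>e * (t - u)\<close>, add up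
  to exactly \<open>e * (v - u)\<close>. This is the form needed for an interval tagged at
  \<open>t\<close>.\<close>

lemma has_vector_derivative_straddle:
  fixes f :: "real \<Rightarrow> 'a::real_normed_vector"
  assumes "(f has_vector_derivative f') (at t)" "0 < e"
  obtains d where "0 < d"
    "\<And>u v. \<lbrakk>u \<le> t; t \<le> v; u \<in> ball t d; v \<in> ball t d\<rbrakk>
       \<Longrightarrow> norm (f v - f u - (v - u) *\<^sub>R f') \<le> e * (v - u)"
proof -
  from assms obtain d where "0 < d" and
    d: "\<And>y. norm (y - t) < d \<Longrightarrow> norm (f y - f t - (y - t) *\<^sub>R f') \<le> e * norm (y - t)"
    unfolding has_vector_derivative_def has_derivative_at_alt by blast
  have "norm (f v - f u - (v - u) *\<^sub>R f') \<le> e * (v - u)"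
    if "u \<le> t" "t \<le> v" "u \<in> ball t d" "v \<in> ball t d" for u v
  proof -
    have "f v - f u - (v - u) *\<^sub>R f'
        = (f v - f t - (v - t) *\<^sub>R f') - (f u - f t - (u - t) *\<^sub>R f')"
      by (simp add: algebra_simps)
    also have "norm \<dots> \<le> e * (v - t) + e * (t - u)"
    proof (rule order.trans[OF norm_triangle_ineq4 add_mono])
      show "norm (f v - f t - (v - t) *\<^sub>R f') \<le> e * (v - t)"
        using d[of v] that by (simp add: dist_real_def)
      show "norm (f u - f t - (u - t) *\<^sub>R f') \<le> e * (t - u)"
        using d[of u] that by (simp add: dist_real_def)
    qed
    finally show ?thesis by (simp add: algebra_simps)
  qed
  with \<open>0 < d\<close> show thesis by (rule that)
qed

text \<open>Disjoint subintervals of a set of small measure have small total length, so absolute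
  continuity controls the increments of \<open>f\<close> over them.\<close>

lemma absolutely_continuous_interval_tagged_sum:
  assumes ac: "absolutely_continuous_interval a b f" and "0 < e"
  obtains \<delta> where "0 < \<delta>"
    "\<And>p U. \<lbrakk>p tagged_partial_division_of {a..b}; U \<in> lmeasurable; measure lebesgue U < \<delta>;
        \<And>x K. (x, K) \<in> p \<Longrightarrow> K \<subseteq> U\<rbrakk>
      \<Longrightarrow> (\<Sum>(x, K)\<in>p. norm (f (Sup K) - f (Inf K))) < e"
proof -
  obtain \<delta> where "0 < \<delta>" and
    \<delta>: "\<forall>P. interval_family a b P \<longrightarrow> (\<Sum>(s, t)\<in>P. t - s) < \<delta>
      \<longrightarrow> (\<Sum>(s, t)\<in>P. norm (f t - f s)) < e"
    using assms unfolding absolutely_continuous_interval_iff by meson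
  have "(\<Sum>(x, K)\<in>p. norm (f (Sup K) - f (Inf K))) < e"
    if p: "p tagged_partial_division_of {a..b}" and U: "U \<in> lmeasurable" "measure lebesgue U < \<delta>"
      and pU: "\<And>x K. (x, K) \<in> p \<Longrightarrow> K \<subseteq> U" for p U
  proof -
    define D where "D = snd ` p"
    define ends where "ends K = (Inf K, Sup K)" for K :: "real set"
    have p': "p tagged_division_of \<Union> D"
      unfolding D_def by (rule tagged_partial_division_of_Union_self[OF p])
    have D: "D division_of \<Union> D"
      unfolding D_def by (metis D_def p' division_of_tagged_division)
    have K: "\<exists>u v. K = {u..v} \<and> u \<le> v \<and> a \<le> u \<and> v \<le> b \<and> K \<subseteq> U" if KD: "K \<in> D" for K
    proof -
      obtain x where x: "(x, K) \<in> p" using KD unfolding D_def by force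
      obtain u v where uv: "K = {u..v}"
        using tagged_partial_division_ofD(4)[OF p x] by auto
      moreover have "u \<le> v"
        using tagged_partial_division_ofD(2)[OF p x] uv by auto
      ultimately show ?thesis
        using tagged_partial_division_ofD(3)[OF p x] pU[OF x] by auto
    qed
    have inj: "inj_on ends D"
    proof (rule inj_onI)
      fix I J assume "I \<in> D" "J \<in> D" "ends I = ends J"
      then show "I = J"
        using K[of I] K[of J] by (auto simp: ends_def)
    qed
    \<comment> \<open>Passing from tagged pairs to intervals requires a summand that vanishes on
      every box with empty interior. The empty box is one of them, and there \<open>Sup\<close> and
      \<open>Inf\<close> say nothing useful, hence the case distinction.\<close>
    let ?d = "\<lambda>K. if K = {} then 0 else norm (f (Sup K) - f (Inf K))"
    have "(\<Sum>(x, K)\<in>p. norm (f (Sup K) - f (Inf K))) = (\<Sum>(x, K)\<in>p. ?d K)"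
      using tagged_partial_division_ofD(2)[OF p] by (intro sum.cong) (auto, blast)
    also have "\<dots> = (\<Sum>K\<in>D. ?d K)"
      unfolding D_def
    proof (rule sum.over_tagged_division_lemma[OF p'])
      fix u v :: real assume "box u v = {}"
      then show "?d (cbox u v) = 0"
        by (cases "u = v") auto
    qed
    also have "\<dots> = (\<Sum>K\<in>D. norm (f (Sup K) - f (Inf K)))"
      using K by (intro sum.cong refl) fastforce
    also have "\<dots> = (\<Sum>(s, t)\<in>ends ` D. norm (f t - f s))"
      by (subst sum.reindex[OF inj]) (simp add: ends_def)
    also have "\<dots> < e"
    proof (rule \<delta>[rule_format])
      show "interval_family a b (ends ` D)"
        unfolding interval_family_def
      proof (intro conjI)
        show "finite (ends ` D)" using D by auto
        show "\<forall>(s, t)\<in>ends ` D. a \<le> s \<and> s \<le> t \<and> t \<le> b"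
          using K by (fastforce simp: ends_def)
        show "pairwise (\<lambda>p q. disjnt {fst p<..<snd p} {fst q<..<snd q}) (ends ` D)"
        proof (rule pairwiseI)
          fix P Q assume "P \<in> ends ` D" "Q \<in> ends ` D" "P \<noteq> Q"
          then obtain I J where IJ: "I \<in> D" "J \<in> D" "I \<noteq> J" "P = ends I" "Q = ends J" by auto
          then have "interior I \<inter> interior J = {}" using division_ofD(5)[OF D] by blast
          moreover obtain u v where "I = {u..v}" "u \<le> v" using K[OF \<open>I \<in> D\<close>] by blast
          moreover obtain u' v' where "J = {u'..v'}" "u' \<le> v'" using K[OF \<open>J \<in> D\<close>] by blast
          ultimately show "disjnt {fst P<..<snd P} {fst Q<..<snd Q}"
            using IJ by (simp add: ends_def disjnt_def)
        qed
      qed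
      have "(\<Sum>(s, t)\<in>ends ` D. t - s) = (\<Sum>K\<in>D. Sup K - Inf K)"
        by (subst sum.reindex[OF inj]) (simp add: ends_def)
      also have "\<dots> = (\<Sum>K\<in>D. measure lebesgue K)"
        by (rule sum.cong) (use K in fastforce)+
      also have "\<dots> = measure lebesgue (\<Union> D)"
        by (rule content_division[OF D])
      also have "\<dots> \<le> measure lebesgue U"
        using K U D by (intro measure_mono_fmeasurable) (auto, fastforce)
      finally show "(\<Sum>(s, t)\<in>ends ` D. t - s) < \<delta>" using U by simp
    qed
    finally show ?thesis .
  qed
  with \<open>0 < \<delta>\<close> show thesis by (rule that)
qed

text \<open>Absolute continuity rules out Cantor-like growth: over a fine tagged division, the intervals
  tagged in the exceptional null set lie in an open set of small measure and contribute little, and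
  the straddle lemma controls the others.\<close>

lemma absolutely_continuous_norm_diff_le:
  fixes f :: "real \<Rightarrow> 'a::real_normed_vector" and \<phi> \<phi>' :: "real \<Rightarrow> real"
  assumes "a \<le> b" and ac: "absolutely_continuous_interval a b f"
    and ae: "AE t in lebesgue_on {a<..<b}.
      \<exists>f'. (f has_vector_derivative f') (at t) \<and> norm f' \<le> \<phi>' t"
    and \<phi>: "\<And>t. \<lbrakk>a < t; t < b\<rbrakk> \<Longrightarrow> (\<phi> has_real_derivative \<phi>' t) (at t)"
    and mono: "mono_on {a..b} \<phi>"
  shows "norm (f b - f a) \<le> \<phi> b - \<phi> a"
proof (rule field_le_epsilon)
  fix e :: real assume "0 < e"
  \<comment> \<open>The budget: one \<open>\<eta>\<close> for all intervals tagged in the null set,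
    and \<open>2 * \<eta>\<close> per unit length elsewhere, since \<open>f\<close> and
    \<open>\<phi>\<close> each incur a straddle error. The total is exactly
    \<open>e\<close>.\<close>
  define \<eta> where "\<eta> = e / (2 * (b - a) + 1)"
  have "0 < 2 * (b - a) + 1" using \<open>a \<le> b\<close> by simp
  then have "0 < \<eta>" "\<eta> * (2 * (b - a) + 1) = e"
    using \<open>0 < e\<close> by (simp_all add: \<eta>_def)
  then have \<eta>: "0 < \<eta>" "\<eta> + 2 * \<eta> * (b - a) = e"
    by (simp_all add: algebra_simps)
  have "AE t in lebesgue. t \<in> {a<..<b} \<longrightarrow>
      (\<exists>f'. (f has_vector_derivative f') (at t) \<and> norm f' \<le> \<phi>' t)"
    using ae by (subst (asm) AE_restrict_space_iff) auto
  then obtain N0 where N0: "N0 \<in> null_sets lebesgue"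
    and N0': "{t \<in> space lebesgue. \<not> (t \<in> {a<..<b} \<longrightarrow>
        (\<exists>f'. (f has_vector_derivative f') (at t) \<and> norm f' \<le> \<phi>' t))} \<subseteq> N0"
    unfolding eventually_ae_filter by blast
  \<comment> \<open>The endpoints join the exceptional set because derivatives are known only in the
    open interval.\<close>
  define N where "N = N0 \<union> {a, b}"
  have "negligible N"
    using N0 by (simp add: N_def negligible_iff_null_sets)
  obtain \<delta> where "0 < \<delta>" and \<delta>:
    "\<And>p U. \<lbrakk>p tagged_partial_division_of {a..b}; U \<in> lmeasurable; measure lebesgue U < \<delta>;
        \<And>x K. (x, K) \<in> p \<Longrightarrow> K \<subseteq> U\<rbrakk>
      \<Longrightarrow> (\<Sum>(x, K)\<in>p. norm (f (Sup K) - f (Inf K))) < \<eta>"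
    using absolutely_continuous_interval_tagged_sum[OF ac \<eta>(1)] by blast
  have N: "N \<in> lmeasurable" "measure lebesgue N = 0"
    using \<open>negligible N\<close> negligible_imp_measurable negligible_imp_measure0 by blast+
  obtain U where U0: "open U" "N \<subseteq> U" "U - N \<in> lmeasurable"
      "emeasure lebesgue (U - N) < ennreal \<delta>"
    using sets_lebesgue_outer_open[OF fmeasurableD[OF N(1)] \<open>0 < \<delta>\<close>] by blast
  have "U = N \<union> (U - N)" using U0(2) by auto
  then have "U \<in> lmeasurable" "measure lebesgue U \<le> measure lebesgue N + measure lebesgue (U - N)"
    using N(1) U0(3) fmeasurable.Un measure_Un_le[of N lebesgue "U - N"]
    by (metis, metis fmeasurableD)
  moreover have "measure lebesgue (U - N) < \<delta>"
    using U0(3,4) by (simp add: emeasure_eq_measure2 ennreal_less_iff)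
  ultimately have U: "open U" "N \<subseteq> U" "U \<in> lmeasurable" "measure lebesgue U < \<delta>"
    using U0 N(2) by auto
  let ?good = "\<lambda>g t. \<forall>u v. u \<le> t \<longrightarrow> t \<le> v \<longrightarrow> u \<in> g \<longrightarrow> v \<in> g
      \<longrightarrow> norm (f v - f u) \<le> \<phi> v - \<phi> u + 2 * \<eta> * (v - u)"
  \<comment> \<open>The gauge has two regimes: at exceptional tags it confines intervals to the
    small open set \<open>U\<close>, at the others it is fine enough for the straddle estimates.
    Outside \<open>{a..b}\<close> any open set serves.\<close>
  have "\<exists>g. open g \<and> t \<in> g \<and> (t \<in> {a..b} \<longrightarrow> (if t \<in> N then g \<subseteq> U else ?good g t))" for t
  proof (cases "t \<in> {a..b} - N")
    case False
    then show ?thesis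
      using U by (cases "t \<in> N") (auto intro: exI[of _ U] exI[of _ UNIV])
  next
    case True
    then have t: "a < t" "t < b" "t \<notin> N0" by (auto simp: N_def less_le)
    then obtain f' where f': "(f has_vector_derivative f') (at t)" "norm f' \<le> \<phi>' t"
      using N0' by auto
    obtain d where "0 < d" and d: "\<And>u v. \<lbrakk>u \<le> t; t \<le> v; u \<in> ball t d; v \<in> ball t d\<rbrakk>
       \<Longrightarrow> norm (f v - f u - (v - u) *\<^sub>R f') \<le> \<eta> * (v - u)"
      using has_vector_derivative_straddle[OF f'(1) \<eta>(1)] by blast
    have "(\<phi> has_vector_derivative \<phi>' t) (at t)"
      using \<phi>[OF t(1,2)] by (simp add: has_real_derivative_iff_has_vector_derivative)
    then obtain d' where "0 < d'" and d': "\<And>u v. \<lbrakk>u \<le> t; t \<le> v; u \<in> ball t d'; v \<in> ball t d'\<rbrakk>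
       \<Longrightarrow> norm (\<phi> v - \<phi> u - (v - u) *\<^sub>R \<phi>' t) \<le> \<eta> * (v - u)"
      using has_vector_derivative_straddle[OF _ \<eta>(1)] by blast
    have "norm (f v - f u) \<le> \<phi> v - \<phi> u + 2 * \<eta> * (v - u)"
      if uv: "u \<le> t" "t \<le> v" "u \<in> ball t (min d d')" "v \<in> ball t (min d d')" for u v
    proof -
      have "norm (f v - f u) \<le> norm (f v - f u - (v - u) *\<^sub>R f') + norm ((v - u) *\<^sub>R f')"
        by (metis diff_add_cancel norm_triangle_ineq)
      also have "\<dots> \<le> \<eta> * (v - u) + (v - u) * \<phi>' t"
        using d[of u v] uv f'(2) by (intro add_mono) (auto intro: mult_left_mono)
      \<comment> \<open>The straddle estimate for \<open>\<phi>\<close> is read backwards here: the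
        linear term is bounded by the true increment plus an error.\<close>
      also have "(v - u) * \<phi>' t \<le> \<phi> v - \<phi> u + \<eta> * (v - u)"
        using d'[of u v] uv by (auto simp: abs_le_iff)
      finally show ?thesis by (simp add: algebra_simps)
    qed
    then show ?thesis
      using True \<open>0 < d\<close> \<open>0 < d'\<close> by (intro exI[of _ "ball t (min d d')"]) auto
  qed
  then obtain G where G: "\<And>t. open (G t)" "\<And>t. t \<in> G t"
    "\<And>t. t \<in> {a..b} \<Longrightarrow> if t \<in> N then G t \<subseteq> U else ?good (G t) t"
    by metis
  have "gauge G" using G(1,2) by (simp add: gauge_def)
  then obtain p where p: "p tagged_division_of {a..b}" "G fine p"
    by (rule fine_division_exists_real)
  have p': "p tagged_partial_division_of {a..b}"
    using p(1) by (simp add: tagged_division_of_def)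
  have fin: "finite p" using p(1) by blast
  have K: "x \<in> {a..b} \<and> K \<subseteq> G x \<and> Inf K \<in> K \<and> Sup K \<in> K \<and> Inf K \<le> x \<and> x \<le> Sup K \<and> K \<subseteq> {a..b}"
    if xK: "(x, K) \<in> p" for x K
  proof -
    obtain u v where uv: "K = {u..v}"
      using tagged_partial_division_ofD(4)[OF p' xK] by auto
    moreover have "x \<in> K" "K \<subseteq> {a..b}" "K \<subseteq> G x"
      using tagged_partial_division_ofD(2,3)[OF p' xK] fineD[OF p(2) xK] by auto
    ultimately show ?thesis by auto
  qed
  define q where "q = {(x, K) \<in> p. x \<in> N}"
  have q: "q \<subseteq> p" by (auto simp: q_def)
  let ?F = "\<lambda>(x::real, K). norm (f (Sup K) - f (Inf K))"
  let ?H = "\<lambda>(x::real, K). \<phi> (Sup K) - \<phi> (Inf K) + 2 * \<eta> * (Sup K - Inf K)"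
  have "norm (f b - f a) = norm (\<Sum>(x, K)\<in>p. f (Sup K) - f (Inf K))"
    using additive_tagged_division_1[OF \<open>a \<le> b\<close> p(1), of f] by simp
  also have "\<dots> \<le> sum ?F p"
    by (rule order.trans[OF norm_sum]) (simp add: case_prod_unfold)
  also have "\<dots> = sum ?F (p - q) + sum ?F q"
    by (rule sum.subset_diff[OF q fin])
  also have "sum ?F q \<le> \<eta>"
  proof (rule less_imp_le, rule \<delta>[OF _ U(3,4)])
    show "q tagged_partial_division_of {a..b}"
      by (rule tagged_partial_division_subset[OF p' q])
    show "\<And>x K. (x, K) \<in> q \<Longrightarrow> K \<subseteq> U"
      using K G(3) by (fastforce simp: q_def)
  qed
  also have "sum ?F (p - q) \<le> sum ?H (p - q)"
  proof (rule sum_mono, clarify)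
    fix x K assume "(x, K) \<in> p" "(x, K) \<notin> q"
    then have "x \<notin> N" "(x, K) \<in> p" by (auto simp: q_def)
    with K[of x K] G(3)[of x]
    show "norm (f (Sup K) - f (Inf K)) \<le> \<phi> (Sup K) - \<phi> (Inf K) + 2 * \<eta> * (Sup K - Inf K)"
      by (auto simp: subset_iff)
  qed
  \<comment> \<open>The pairs tagged in \<open>N\<close> are put back so that the sum can telescope
    over all of \<open>{a..b}\<close>. Their terms must be nonnegative for this, which is where
    monotonicity of \<open>\<phi>\<close> enters.\<close>
  also have "sum ?H (p - q) \<le> sum ?H p"
  proof (rule sum_mono2[OF fin])
    fix P assume "P \<in> p - (p - q)"
    then obtain x K where P: "P = (x, K)" and "(x, K) \<in> p" by (cases P) auto
    then have "\<phi> (Inf K) \<le> \<phi> (Sup K)" "Inf K \<le> Sup K"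
      using K[of x K] by (auto intro!: mono_onD[OF mono])
    then show "0 \<le> ?H P"
      using \<eta>(1) by (simp add: P)
  qed blast
  \<comment> \<open>The error term is absorbed into the potential: each summand is an increment of
    \<open>\<phi> s + 2 * \<eta> * s\<close>.\<close>
  also have "sum ?H p = (\<Sum>(x, K)\<in>p. (\<phi> (Sup K) + 2 * \<eta> * Sup K) - (\<phi> (Inf K) + 2 * \<eta> * Inf K))"
    by (rule sum.cong) (auto simp: algebra_simps)
  also have "\<dots> = (\<phi> b + 2 * \<eta> * b) - (\<phi> a + 2 * \<eta> * a)"
    by (rule additive_tagged_division_1[OF \<open>a \<le> b\<close> p(1)])
  finally show "norm (f b - f a) \<le> \<phi> b - \<phi> a + e"
    using \<eta>(2) by (simp add: algebra_simps)
qed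

section \<open>Gronwall's argument\<close>

text \<open>Iterating the differential inequality gives \<open>norm (z t) \<le> M * (K * t) ^ n / fact n\<close>
  for every \<open>n\<close>.\<close>

lemma absolutely_continuous_gronwall_zero:
  fixes z :: "real \<Rightarrow> 'a::real_normed_vector"
  assumes ac: "absolutely_continuous_interval 0 T z" and "z 0 = 0" and "0 \<le> K"
    and ae: "AE t in lebesgue_on {0<..<T}.
      \<exists>z'. (z has_vector_derivative z') (at t) \<and> norm z' \<le> K * norm (z t)"
    and t: "t \<in> {0..T}"
  shows "z t = 0"
proof -
  have "bounded (z ` {0..T})"
    by (intro compact_imp_bounded compact_continuous_image
        absolutely_continuous_interval_imp_continuous_on[OF ac]) auto
  then obtain M where "0 < M" and M: "\<And>t. t \<in> {0..T} \<Longrightarrow> norm (z t) \<le> M"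
    unfolding bounded_pos by blast
  have AE: "AE t in lebesgue. t \<in> {0<..<T} \<longrightarrow>
      (\<exists>z'. (z has_vector_derivative z') (at t) \<and> norm z' \<le> K * norm (z t))"
    using ae by (subst (asm) AE_restrict_space_iff) auto
  have bound: "norm (z t) \<le> M * (K * t) ^ n / fact n" if "t \<in> {0..T}" for n t
    using that
  proof (induction n arbitrary: t)
    case 0
    then show ?case using M by simp
  next
    case (Suc n)
    \<comment> \<open>\<open>\<phi>'\<close> is \<open>K\<close> times the bound of the induction
      hypothesis, and \<open>\<phi>\<close> is its primitive vanishing at 0, which is the bound for
      \<open>Suc n\<close>.\<close>
    define \<phi> where "\<phi> s = M * (K * s) ^ Suc n / fact (Suc n)" for s
    define \<phi>' where "\<phi>' s = K * (M * (K * s) ^ n / fact n)" for s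
    have "norm (z t - z 0) \<le> \<phi> t - \<phi> 0"
    proof (rule absolutely_continuous_norm_diff_le[where \<phi>' = \<phi>'])
      show "0 \<le> t" "absolutely_continuous_interval 0 t z"
        using Suc.prems absolutely_continuous_interval_subset[OF ac] by auto
      show "AE s in lebesgue_on {0<..<t}.
          \<exists>z'. (z has_vector_derivative z') (at s) \<and> norm z' \<le> \<phi>' s"
      proof (subst AE_restrict_space_iff)
        show "AE s in lebesgue. s \<in> {0<..<t} \<longrightarrow>
            (\<exists>z'. (z has_vector_derivative z') (at s) \<and> norm z' \<le> \<phi>' s)"
          using AE
        proof (rule AE_mp, intro AE_I2 impI)
          fix s assume s: "s \<in> {0<..<t}" and "s \<in> {0<..<T} \<longrightarrow>
              (\<exists>z'. (z has_vector_derivative z') (at s) \<and> norm z' \<le> K * norm (z s))"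
          then obtain z' where "(z has_vector_derivative z') (at s)" "norm z' \<le> K * norm (z s)"
            using Suc.prems by auto
          moreover have "K * norm (z s) \<le> \<phi>' s"
            unfolding \<phi>'_def using Suc s \<open>0 \<le> K\<close> by (intro mult_left_mono) auto
          ultimately show "\<exists>z'. (z has_vector_derivative z') (at s) \<and> norm z' \<le> \<phi>' s"
            by (meson order.trans)
        qed
      qed auto
      show "(\<phi> has_real_derivative \<phi>' s) (at s)" for s
        unfolding \<phi>_def \<phi>'_def
        by (rule derivative_eq_intros refl | simp add: fact_Suc field_simps del: of_nat_Suc)+
      show "mono_on {0..t} \<phi>"
        unfolding \<phi>_def using \<open>0 < M\<close> \<open>0 \<le> K\<close>
        by (intro mono_onI divide_right_mono mult_left_mono power_mono) auto
    qed
    then show ?case using \<open>z 0 = 0\<close> by (simp add: \<phi>_def)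
  qed
  \<comment> \<open>Up to the factor \<open>M\<close> the bounds are the terms of the exponential
    series at \<open>K * t\<close>, so they tend to 0.\<close>
  have "(\<lambda>n. M * (inverse (fact n) * (K * t) ^ n)) \<longlonglongrightarrow> M * 0"
    by (intro tendsto_mult tendsto_const summable_LIMSEQ_zero[OF summable_exp])
  then have "norm (z t) \<le> M * 0"
    by (rule LIMSEQ_le_const) (use bound[OF t] in \<open>auto simp: divide_inverse mult_ac\<close>)
  then show ?thesis by simp
qed

section \<open>Left inverses depending continuously on the matrix\<close>

lemma bounded_bilinear_matrix_matrix_mult:
  "bounded_bilinear ((**) :: real ^ 'n ^ 'm \<Rightarrow> real ^ 'p ^ 'n \<Rightarrow> real ^ 'p ^ 'm)"
  unfolding bilinear_conv_bounded_bilinear[symmetric] bilinear_def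
  by (intro conjI allI linearI)
    (auto simp: vec_eq_iff matrix_matrix_mult_def sum.distrib sum_distrib_left algebra_simps)

lemma continuous_on_det:
  fixes A :: "'a::topological_space \<Rightarrow> real ^ 'n ^ 'n"
  assumes "continuous_on S A"
  shows "continuous_on S (\<lambda>x. det (A x))"
  unfolding det_def by (intro continuous_intros assms)

lemma matrix_inv_inverse:
  assumes "invertible A"
  shows "A ** matrix_inv A = mat 1" "matrix_inv A ** A = mat 1"
  using someI_ex[OF assms[unfolded invertible_def]] by (simp_all add: matrix_inv_def)

text \<open>By Cramer's rule every entry of the inverse is a quotient of determinants, and
  determinants are polynomials in the entries.\<close>

lemma continuous_on_matrix_inv:
  fixes A :: "'a::topological_space \<Rightarrow> real ^ 'n ^ 'n"
  assumes "continuous_on S A" and det: "\<And>x. x \<in> S \<Longrightarrow> det (A x) \<noteq> 0"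
  shows "continuous_on S (\<lambda>x. matrix_inv (A x))"
proof -
  let ?cramer = "\<lambda>x. \<chi> k j. det (\<chi> i l. if l = k then axis j 1 $ i else A x $ i $ l) / det (A x)"
  have "matrix_inv (A x) = ?cramer x" if "x \<in> S" for x
  proof -
    have "A x ** matrix_inv (A x) = mat 1"
      using matrix_inv_inverse(1) det[OF that] invertible_det_nz by blast
    then have "A x *v (matrix_inv (A x) *v axis j 1) = axis j 1" for j
      by (simp add: matrix_vector_mul_assoc)
    then have "matrix_inv (A x) *v axis j 1
        = (\<chi> k. det (\<chi> i l. if l = k then axis j 1 $ i else A x $ i $ l) / det (A x))" for j
      using cramer[OF det[OF that]] by blast
    then have "matrix_inv (A x) $ k $ j = ?cramer x $ k $ j" for k j
      by (simp add: matrix_vector_mult_basis column_def vec_eq_iff)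
    then show ?thesis by (simp add: vec_eq_iff)
  qed
  moreover have "continuous_on S ?cramer"
  proof -
    have "continuous_on S (\<lambda>x. if l = k then axis j 1 $ i else A x $ i $ l)" for i j k l
      by (cases "l = k") (auto intro!: continuous_intros assms)
    then show ?thesis
      using det by (intro continuous_intros continuous_on_det assms) auto
  qed
  ultimately show ?thesis
    by (subst continuous_on_cong[OF refl, of S _ ?cramer]) auto
qed

text \<open>Injectivity lets a combination indexed by \<open>i\<close> be rewritten as one over the
  set of columns without merging coefficients; there \<open>independent\<close> forces all of them
  to vanish.\<close>

lemma independent_columns_imp_left_inverse:
  fixes A :: "real ^ 'n ^ 'm"
  assumes "independent_family (\<lambda>i. column i A)"
  obtains L :: "real ^ 'm ^ 'n" where "L ** A = mat 1"
proof -
  let ?col = "\<lambda>i. column i A"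
  have inj: "inj ?col" and ind: "independent (range ?col)"
    using assms by (auto simp: independent_family_def)
  have "c i = 0" if "(\<Sum>i\<in>UNIV. c i *s ?col i) = 0" for c i
  proof -
    have "(\<Sum>v\<in>range ?col. c (inv ?col v) *\<^sub>R v) = (\<Sum>i\<in>UNIV. c i *s ?col i)"
      by (subst sum.reindex[OF inj]) (simp add: inv_f_f[OF inj] scalar_mult_eq_scaleR)
    then have "c (inv ?col (?col i)) = 0"
      using that by (intro independentD[OF ind, of "range ?col"]) auto
    then show ?thesis by (simp add: inv_f_f[OF inj])
  qed
  then show thesis
    using that matrix_left_invertible_independent_columns[of A] by blast
qed

text \<open>\<open>A x\<close> is rectangular, so it cannot be inverted directly. A left inverse
  \<open>L\<close> of \<open>A a\<close> is frozen instead: \<open>L ** A x\<close> is square, is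
  the identity at \<open>a\<close>, and so stays invertible near \<open>a\<close>. Then
  \<open>matrix_inv (L ** A x) ** L\<close> is a left inverse of \<open>A x\<close>, and compactness
  of the closed ball bounds it.\<close>

lemma continuous_left_inverse:
  fixes A :: "'a::heine_borel \<Rightarrow> real ^ 'n ^ 'm"
  assumes A: "continuous_on UNIV A" and "independent_family (\<lambda>i. column i (A a))"
  shows "\<exists>r>0. \<exists>B>0. \<exists>G. continuous_on (cball a r) G
    \<and> (\<forall>x\<in>cball a r. G x ** A x = mat 1 \<and> norm (G x) \<le> B)"
proof -
  interpret mult: bounded_bilinear "(**) :: real ^ 'm ^ 'n \<Rightarrow> real ^ 'n ^ 'm \<Rightarrow> real ^ 'n ^ 'n"
    by (rule bounded_bilinear_matrix_matrix_mult)
  interpret mult': bounded_bilinear "(**) :: real ^ 'n ^ 'n \<Rightarrow> real ^ 'm ^ 'n \<Rightarrow> real ^ 'm ^ 'n"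
    by (rule bounded_bilinear_matrix_matrix_mult)
  obtain L :: "real ^ 'm ^ 'n" where L: "L ** A a = mat 1"
    using independent_columns_imp_left_inverse[OF assms(2)] .
  have contLA: "continuous_on UNIV (\<lambda>x. L ** A x)"
    by (intro mult.continuous_on A continuous_on_const)
  have "open {x. det (L ** A x) \<noteq> 0}"
    by (intro open_Collect_neq continuous_on_det contLA continuous_on_const)
  moreover have "a \<in> {x. det (L ** A x) \<noteq> 0}" using L by simp
  ultimately obtain r where "0 < r" and r: "cball a r \<subseteq> {x. det (L ** A x) \<noteq> 0}"
    by (meson open_contains_cball)
  define G where "G x = matrix_inv (L ** A x) ** L" for x
  have contG: "continuous_on (cball a r) G"
    unfolding G_def using r
    by (intro mult'.continuous_on continuous_on_const continuous_on_matrix_inv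
        continuous_on_subset[OF contLA]) auto
  have "G x ** A x = mat 1" if "x \<in> cball a r" for x
  proof -
    have "invertible (L ** A x)" using r that by (auto simp: invertible_det_nz)
    then show ?thesis
      by (simp add: G_def matrix_inv_inverse(2) flip: matrix_mul_assoc)
  qed
  moreover have "bounded (G ` cball a r)"
    by (intro compact_imp_bounded compact_continuous_image contG compact_cball)
  then obtain B where "0 < B" "\<And>x. x \<in> cball a r \<Longrightarrow> norm (G x) \<le> B"
    unfolding bounded_pos by auto
  ultimately show ?thesis using \<open>0 < r\<close> contG by blast
qed

section \<open>Stacked vectors as matrices\<close>

text \<open>With the sub-vectors as columns, \<open>block_diag w\<close> becomes left multiplication
  by \<open>w\<close>, so finding the weight amounts to solving one matrix equation.\<close>

definition stack_matrix :: "real ^ ('n::finite \<times> 'd::finite) \<Rightarrow> real ^ 'n ^ 'd" where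
  "stack_matrix x = (\<chi> k i. x $ (i, k))"

lemma column_stack_matrix: "column i (stack_matrix x) = subvec x i"
  by (simp add: stack_matrix_def subvec_def column_def vec_eq_iff)

lemma subvec_componentwise: "subvec (componentwise \<sigma> x) i = componentwise \<sigma> (subvec x i)"
  by (simp add: subvec_def componentwise_def)

lemma stack_matrix_eq_iff: "stack_matrix x = stack_matrix y \<longleftrightarrow> x = y"
  by (auto simp: stack_matrix_def vec_eq_iff)

lemma bounded_linear_stack_matrix: "bounded_linear stack_matrix"
  by (intro linear_conv_bounded_linear[THEN iffD1] linearI)
    (auto simp: stack_matrix_def vec_eq_iff)

lemma stack_matrix_block_diag:
  "stack_matrix (block_diag w *v x) = w ** stack_matrix x"
proof -
  have "(\<Sum>q\<in>UNIV. (if i = fst q then w $ k $ snd q else 0) * x $ q)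
      = (\<Sum>l\<in>UNIV. w $ k $ l * x $ (i, l))" for i k
  proof -
    have "(\<Sum>q\<in>UNIV. (if i = fst q then w $ k $ snd q else 0) * x $ q)
        = (\<Sum>j\<in>UNIV. \<Sum>l\<in>UNIV. (if i = j then w $ k $ l else 0) * x $ (j, l))"
      by (simp add: sum.cartesian_product case_prod_unfold flip: UNIV_Times_UNIV)
    also have "\<dots> = (\<Sum>j\<in>UNIV. if i = j then (\<Sum>l\<in>UNIV. w $ k $ l * x $ (j, l)) else 0)"
      by (rule sum.cong) auto
    finally show ?thesis by simp
  qed
  then show ?thesis
    by (simp add: stack_matrix_def block_diag_def vec_eq_iff matrix_vector_mult_def
        matrix_matrix_mult_def)
qed

text \<open>Bilinearity in finite dimension yields a constant bounding the product by
  \<open>norm w * norm x\<close>; its value never matters.\<close>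

lemma bounded_bilinear_block_diag:
  "bounded_bilinear (\<lambda>w (x :: real ^ ('n::finite \<times> 'd::finite)). block_diag w *v x)"
  unfolding bilinear_conv_bounded_bilinear[symmetric] bilinear_def
proof (intro conjI allI)
  have "block_diag (w + w') = (block_diag w + block_diag w' :: real ^ ('n \<times> 'd) ^ ('n \<times> 'd))"
    and "block_diag (c *\<^sub>R w) = (c *\<^sub>R block_diag w :: real ^ ('n \<times> 'd) ^ ('n \<times> 'd))" for c w w'
    by (simp_all add: block_diag_def vec_eq_iff)
  then show "linear (\<lambda>w. block_diag w *v x)" for x :: "real ^ ('n \<times> 'd)"
    by (intro linearI) (simp_all add: matrix_vector_mult_add_rdistrib scaleR_matrix_vector_assoc)
qed auto

text \<open>Comparing entry by entry with \<open>L *\<^sub>R (u - v)\<close> keeps the constant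
  \<open>L\<close>, with no factor from the dimension.\<close>

lemma lipschitz_on_componentwise:
  assumes "L-lipschitz_on UNIV \<sigma>"
  shows "L-lipschitz_on UNIV (componentwise \<sigma> :: real ^ 'm::finite \<Rightarrow> _)"
proof (rule lipschitz_onI)
  show L: "0 \<le> L" using assms lipschitz_on_nonneg by blast
  fix u v :: "real ^ 'm"
  have "norm (componentwise \<sigma> u - componentwise \<sigma> v) \<le> norm (L *\<^sub>R (u - v))"
  proof (rule norm_le_componentwise_cart)
    show "norm ((componentwise \<sigma> u - componentwise \<sigma> v) $ i) \<le> norm ((L *\<^sub>R (u - v)) $ i)" for i
      using lipschitz_onD[OF assms, of "u $ i" "v $ i"] L
      by (simp add: componentwise_def dist_real_def abs_mult)
  qed
  then show "dist (componentwise \<sigma> u) (componentwise \<sigma> v) \<le> L * dist u v"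
    using L by (simp add: dist_norm)
qed

section \<open>Uniqueness of Caratheodory solutions\<close>

lemma is_solution_unique:
  fixes x y :: "real \<Rightarrow> real ^ ('n::finite \<times> 'd::finite)"
  assumes "L-lipschitz_on UNIV \<sigma>" and w: "\<And>t. t \<in> {0<..<T} \<Longrightarrow> norm (w t) \<le> W"
    and x: "is_solution \<sigma> T w x0 x" and y: "is_solution \<sigma> T w x0 y" and t: "t \<in> {0..T}"
  shows "y t = x t"
proof -
  interpret block: bounded_bilinear "\<lambda>w (x :: real ^ ('n \<times> 'd)). block_diag w *v x"
    by (rule bounded_bilinear_block_diag)
  obtain K where "0 \<le> K" and
    K: "\<And>w (x :: real ^ ('n \<times> 'd)). norm (block_diag w *v x) \<le> norm w * norm x * K"
    using block.nonneg_bounded by blast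
  note lip = lipschitz_on_componentwise[OF assms(1), where 'm = "'n \<times> 'd"]
  have L: "0 \<le> L" using assms(1) lipschitz_on_nonneg by blast
  have "y t - x t = 0"
  proof (rule absolutely_continuous_gronwall_zero[where z = "\<lambda>t. y t - x t", OF _ _ _ _ t])
    show "y 0 - x 0 = 0" using x y by (simp add: is_solution_def)
    \<comment> \<open>The absolute value is there because an empty time interval would leave the
      sign of \<open>W\<close> undetermined.\<close>
    show "0 \<le> \<bar>W\<bar> * L * K" using L \<open>0 \<le> K\<close> by simp
    show "absolutely_continuous_interval 0 T (\<lambda>t. y t - x t)"
      using x y by (intro absolutely_continuous_interval_diff) (auto simp: is_solution_def)
    show "AE t in lebesgue_on {0<..<T}.
        \<exists>z'. ((\<lambda>t. y t - x t) has_vector_derivative z') (at t)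
          \<and> norm z' \<le> \<bar>W\<bar> * L * K * norm (y t - x t)"
    proof -
      have "AE t in lebesgue_on {0<..<T}.
            (x has_vector_derivative block_diag (w t) *v componentwise \<sigma> (x t)) (at t)"
        and "AE t in lebesgue_on {0<..<T}.
            (y has_vector_derivative block_diag (w t) *v componentwise \<sigma> (y t)) (at t)"
        using x y by (auto simp: is_solution_def)
      moreover have "AE t in lebesgue_on {0<..<T}. t \<in> {0<..<T}"
        by (rule AE_I2) simp
      ultimately show ?thesis
      proof (eventually_elim, goal_cases)
        case (1 t)
        let ?d = "componentwise \<sigma> (y t) - componentwise \<sigma> (x t)"
        show ?case
        proof (intro exI[of _ "block_diag (w t) *v ?d"] conjI)
          show "((\<lambda>t. y t - x t) has_vector_derivative block_diag (w t) *v ?d) (at t)"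
            using has_vector_derivative_diff[OF 1(2) 1(1)] by (simp add: block.diff_right)
          have "norm (block_diag (w t) *v ?d) \<le> norm (w t) * norm ?d * K"
            by (rule K)
          also have "\<dots> \<le> \<bar>W\<bar> * (L * norm (y t - x t)) * K"
            using lipschitz_onD[OF lip, of "y t" "x t"] \<open>0 \<le> K\<close> w[OF 1(3)]
            by (intro mult_right_mono mult_mono) (auto simp: dist_norm)
          finally show "norm (block_diag (w t) *v ?d) \<le> \<bar>W\<bar> * L * K * norm (y t - x t)"
            by (simp add: mult_ac)
        qed
      qed
    qed
  qed
  then show ?thesis by simp
qed

section \<open>The weight that steers along the segment\<close>

text \<open>Continuity gives measurability; this is why the left inverse has to be continuous in
  \<open>x\<close> and not merely bounded.\<close>

lemma Linf_norm_le:
  assumes "continuous_on {0<..<T} w" and "\<And>t. t \<in> {0<..<T} \<Longrightarrow> norm (w t) \<le> B"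
  shows "w \<in> Linf T" "Linf_norm T w \<le> ereal B"
proof -
  have w: "w \<in> borel_measurable (lebesgue_on {0<..<T})"
    by (intro continuous_imp_measurable_on_sets_lebesgue assms) auto
  show le: "Linf_norm T w \<le> ereal B"
    unfolding Linf_norm_def
    using w assms(2) by (intro esssup_I AE_I2) auto
  then show "w \<in> Linf T"
    using w by (auto simp: Linf_def dest: order.strict_trans1)
qed

theorem theorem5p1:
  fixes \<sigma> :: "real \<Rightarrow> real"
    and x1 :: "real ^ ('n::finite \<times> 'd::finite)"
  assumes "CARD('n) \<le> CARD('d)"
    and "\<sigma> C1_differentiable_on UNIV"
    and "\<exists>L. L-lipschitz_on UNIV \<sigma>"
    and "independent_family (\<lambda>i. componentwise \<sigma> (subvec x1 i))"
  shows "\<exists>r>0. \<exists>C>0. \<forall>T>0. \<forall>x0 :: real ^ ('n \<times> 'd). norm (x0 - x1) \<le> r \<longrightarrow>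
    (\<exists>w :: real \<Rightarrow> real ^ 'd ^ 'd. w \<in> Linf T
      \<and> (\<exists>x. is_solution \<sigma> T w x0 x
           \<and> (\<forall>y. is_solution \<sigma> T w x0 y \<longrightarrow> (\<forall>t\<in>{0..T}. y t = x t))
           \<and> x T = x1)
      \<and> Linf_norm T w \<le> ereal (C / T * norm (x0 - x1)))"
proof -
  obtain L where lip: "L-lipschitz_on UNIV \<sigma>" using assms(3) by blast
  define S :: "real ^ ('n \<times> 'd) \<Rightarrow> real ^ 'n ^ 'd"
    where "S x = stack_matrix (componentwise \<sigma> x)" for x
  have "continuous_on UNIV S"
    unfolding S_def
    by (rule bounded_linear.continuous_on[OF bounded_linear_stack_matrix
          lipschitz_on_continuous_on[OF lipschitz_on_componentwise[OF lip]]])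
  moreover have "independent_family (\<lambda>i. column i (S x1))"
    using assms(4) by (simp add: S_def column_stack_matrix subvec_componentwise)
  ultimately obtain r B and G :: "real ^ ('n \<times> 'd) \<Rightarrow> real ^ 'd ^ 'n"
    where "0 < r" "0 < B" and contG: "continuous_on (cball x1 r) G"
      and G: "\<And>x. x \<in> cball x1 r \<Longrightarrow> G x ** S x = mat 1"
      and B: "\<And>x. x \<in> cball x1 r \<Longrightarrow> norm (G x) \<le> B"
    using continuous_left_inverse[of S x1] by blast
  interpret mult: bounded_bilinear "(**) :: real ^ 'n ^ 'd \<Rightarrow> real ^ 'd ^ 'n \<Rightarrow> real ^ 'd ^ 'd"
    by (rule bounded_bilinear_matrix_matrix_mult)
  obtain K where "0 < K"
    and K: "\<And>(X :: real ^ 'n ^ 'd) (Y :: real ^ 'd ^ 'n). norm (X ** Y) \<le> norm X * norm Y * K"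
    using mult.pos_bounded by blast
  obtain K' where "0 < K'"
    and K': "\<And>x :: real ^ ('n \<times> 'd). norm (stack_matrix x) \<le> norm x * K'"
    using bounded_linear.pos_bounded[OF bounded_linear_stack_matrix] by blast
  \<comment> \<open>The factors come from stacking the velocity, from the left inverse and from the
    matrix product; none depends on \<open>T\<close> or \<open>x0\<close>.\<close>
  define C where "C = K' * B * K"
  have "0 < C" using \<open>0 < K\<close> \<open>0 < K'\<close> \<open>0 < B\<close> by (simp add: C_def)
  have "\<exists>w :: real \<Rightarrow> real ^ 'd ^ 'd. w \<in> Linf T
      \<and> (\<exists>x. is_solution \<sigma> T w x0 x
           \<and> (\<forall>y. is_solution \<sigma> T w x0 y \<longrightarrow> (\<forall>t\<in>{0..T}. y t = x t))
           \<and> x T = x1)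
      \<and> Linf_norm T w \<le> ereal (C / T * norm (x0 - x1))"
    if "0 < T" and x0: "norm (x0 - x1) \<le> r" for T and x0 :: "real ^ ('n \<times> 'd)"
  proof -
    define v where "v = (1 / T) *\<^sub>R (x1 - x0)"
    define x where "x t = x0 + t *\<^sub>R v" for t
    define w where "w t = stack_matrix v ** G (x t)" for t
    have "x T = x1" using \<open>0 < T\<close> by (simp add: x_def v_def)
    have deriv: "(x has_vector_derivative v) (at t)" for t
      unfolding x_def by (auto intro!: derivative_eq_intros)
    \<comment> \<open>Along the segment the vector to \<open>x1\<close> is only rescaled, by
      \<open>1 - t / T\<close> in \<open>[0, 1]\<close>, so the initial distance bounds all later
      ones whatever \<open>T\<close> is.\<close>
    have x_near: "x t \<in> cball x1 r" if "t \<in> {0..T}" for t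
    proof -
      have "x1 - x t = (1 - t / T) *\<^sub>R (x1 - x0)"
        by (simp add: x_def v_def algebra_simps)
      then have "dist x1 (x t) = \<bar>1 - t / T\<bar> * norm (x1 - x0)"
        by (simp add: dist_norm)
      also have "\<dots> \<le> 1 * norm (x1 - x0)"
        using that \<open>0 < T\<close> by (intro mult_right_mono) (auto simp: field_simps abs_le_iff)
      finally show ?thesis using x0 by (simp add: norm_minus_commute)
    qed
    have contw: "continuous_on {0<..<T} w"
      unfolding w_def
    proof (intro mult.continuous_on continuous_on_const continuous_on_compose2[OF contG])
      show "continuous_on {0<..<T} x"
        unfolding x_def by (intro continuous_intros)
      show "x ` {0<..<T} \<subseteq> cball x1 r"
        using x_near by (intro image_subsetI) auto
    qed
    have w_bound: "norm (w t) \<le> C / T * norm (x0 - x1)" if "t \<in> {0<..<T}" for t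
    proof -
      have "norm (w t) \<le> norm (stack_matrix v) * norm (G (x t)) * K"
        unfolding w_def by (rule K)
      also have "\<dots> \<le> (norm v * K') * B * K"
        using that \<open>0 < K\<close> \<open>0 < K'\<close>
        by (intro mult_right_mono mult_mono K' B x_near) auto
      also have "\<dots> = C / T * norm (x0 - x1)"
        using \<open>0 < T\<close> by (simp add: v_def C_def norm_minus_commute)
      finally show ?thesis .
    qed
    have dynamics: "block_diag (w t) *v componentwise \<sigma> (x t) = v" if "t \<in> {0<..<T}" for t
    proof -
      have "stack_matrix (block_diag (w t) *v componentwise \<sigma> (x t))
          = stack_matrix v ** (G (x t) ** S (x t))"
        by (simp add: stack_matrix_block_diag w_def S_def matrix_mul_assoc)
      also have "\<dots> = stack_matrix v"
        using G[OF x_near[of t]] that by simp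
      finally show ?thesis by (simp add: stack_matrix_eq_iff)
    qed
    have "(norm v)-lipschitz_on {0..T} x"
    proof (rule lipschitz_onI)
      have "x s - x t = (s - t) *\<^sub>R v" for s t
        by (simp add: x_def algebra_simps)
      then show "dist (x s) (x t) \<le> norm v * dist s t" for s t
        by (simp add: dist_norm)
    qed simp
    then have sol: "is_solution \<sigma> T w x0 x"
      unfolding is_solution_def
    proof (intro conjI AE_I2)
      show "absolutely_continuous_interval 0 T x"
        by (rule lipschitz_imp_absolutely_continuous_interval) fact
      show "(x has_vector_derivative block_diag (w t) *v componentwise \<sigma> (x t)) (at t)"
        if "t \<in> space (lebesgue_on {0<..<T})" for t
        using deriv dynamics that by simp
      show "x 0 = x0" by (simp add: x_def)
    qed
    have "\<forall>y. is_solution \<sigma> T w x0 y \<longrightarrow> (\<forall>t\<in>{0..T}. y t = x t)"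
      using is_solution_unique[OF lip w_bound sol] by simp
    then show ?thesis
      using Linf_norm_le[OF contw w_bound] sol \<open>x T = x1\<close> by (intro exI[of _ w] conjI exI[of _ x])
  qed
  then show ?thesis using \<open>0 < r\<close> \<open>0 < C\<close> by blast
qed

end
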